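(* Let $c>0$. There is a constant $C$ (depending on $c$) such that every $n$-vertex circle graph $G$ with $\alpha(G)=cn$ satisfies $h(G)\le C\sqrt{n}$.
   Context: A circle graph is a graph whose vertices are a finite set of chords of a circle, two vertices being adjacent iff the corresponding chords cross. $\alpha(G)$ is the independence number. A hitting set of $G$ is a set $T\subseteq V(G)$ meeting every maximum independent set of $G$; $h(G)$ is the minimum size of a hitting set. *)

theory Defs
  imports "HOL-Analysis.Analysis" "Graph_Theory.Pair_Digraph"
begin

definition chord_of_circle :: "complex \<Rightarrow> real \<Rightarrow> complex set \<Rightarrow> bool" where
  "chord_of_circle z r u \<longleftrightarrow>
     (\<exists>a\<in>sphere z r. \<exists>b\<in>sphere z r. a \<noteq> b \<and> u = closed_segment a b)"

text \<open>Two distinct chords cross when they meet inside the circle; chords that only share an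
  endpoint do not cross.\<close>

definition chords_cross :: "complex \<Rightarrow> real \<Rightarrow> complex set \<Rightarrow> complex set \<Rightarrow> bool" where
  "chords_cross z r u v \<longleftrightarrow> u \<noteq> v \<and> u \<inter> v \<inter> ball z r \<noteq> {}"

text \<open>Undirected simple graphs are symmetric loop-free digraphs (locale \<^locale>\<open>pair_graph\<close>).
  The vertices are the chords themselves, so all circle graphs live in one type.\<close>

definition chord_graph :: "complex \<Rightarrow> real \<Rightarrow> complex set set \<Rightarrow> complex set pair_pre_digraph" where
  "chord_graph z r V =
     \<lparr>pverts = V, parcs = {(u, v). u \<in> V \<and> v \<in> V \<and> chords_cross z r u v}\<rparr>"

definition circle_graph :: "complex set pair_pre_digraph \<Rightarrow> bool" where
  "circle_graph G \<longleftrightarrow>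
     (\<exists>z r V. r > 0 \<and> finite V \<and> (\<forall>u\<in>V. chord_of_circle z r u) \<and> G = chord_graph z r V)"

lemma circle_graph_imp_pair_graph:
  assumes "circle_graph G"
  shows "pair_graph G"
proof -
  obtain z r V where V: "finite V" and G: "G = chord_graph z r V"
    using assms by (auto simp: circle_graph_def)
  have "parcs G \<subseteq> V \<times> V"
    by (auto simp: G chord_graph_def)
  with V have "finite (parcs G)"
    using finite_subset by blast
  with V show ?thesis
    by unfold_locales
      (auto simp: G chord_graph_def chords_cross_def Int_commute symmetric_def arcs_ends_def
        arc_to_ends_def intro!: symI)
qed

definition independent_set :: "'a pair_pre_digraph \<Rightarrow> 'a set \<Rightarrow> bool" where
  "independent_set G S \<longleftrightarrow> S \<subseteq> pverts G \<and> (\<forall>u\<in>S. \<forall>v\<in>S. (u, v) \<notin> parcs G)"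

definition independence_number :: "'a pair_pre_digraph \<Rightarrow> nat" where
  "independence_number G = Max (card ` {S. independent_set G S})"

definition maximum_independent_set :: "'a pair_pre_digraph \<Rightarrow> 'a set \<Rightarrow> bool" where
  "maximum_independent_set G S \<longleftrightarrow> independent_set G S \<and> card S = independence_number G"

definition hitting_set :: "'a pair_pre_digraph \<Rightarrow> 'a set \<Rightarrow> bool" where
  "hitting_set G T \<longleftrightarrow>
     T \<subseteq> pverts G \<and> (\<forall>S. maximum_independent_set G S \<longrightarrow> T \<inter> S \<noteq> {})"

text \<open>Only meaningful for a finite graph with at least one vertex: in the empty graph the empty
  set is a maximum independent set, so no hitting set exists.\<close>

definition hitting_number :: "'a pair_pre_digraph \<Rightarrow> nat" where
  "hitting_number G = Min (card ` {T. hitting_set G T})"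

end

theory Submission
  imports Defs
begin

text \<open>Cut the circle open at a point, so that chords become intervals and a maximum independent set
  S becomes a laminar family of intervals. By exchange, the number of members of S enclosed by some
  v in S is the independence number of the graph of chords enclosed by v, so it depends only on v
  and not on S; call it f v.

  If some S has at least sqrt n minimal intervals, these have disjoint interiors, so one of them
  contains at most 2 sqrt n endpoints, and its closed neighbourhood hits every maximum
  independent set. Otherwise the forest of every S has fewer than sqrt n leaves but c n nodes, hence
  a branch-free path of length more than l, for some l of order c sqrt n. Along such a path f takes
  consecutive values, so S meets every class of f modulo l, and some class has at most n / l
  elements.\<close>

section \<open>Counting nodes of a finite forest by its leaves\<close>

definition minimal_elements :: "('a \<Rightarrow> 'a \<Rightarrow> bool) \<Rightarrow> 'a set \<Rightarrow> 'a set" where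
  "minimal_elements le U = {u \<in> U. \<forall>w\<in>U. le w u \<longrightarrow> w = u}"

lemma minimal_elements_down_closed:
  assumes "D \<subseteq> U" "\<And>x w. x \<in> D \<Longrightarrow> w \<in> U \<Longrightarrow> le w x \<Longrightarrow> w \<in> D"
  shows "minimal_elements le D = minimal_elements le U \<inter> D"
  using assms unfolding minimal_elements_def by blast

lemma principal_down_set_down_closed:
  assumes "D \<subseteq> U" "\<And>x w. x \<in> D \<Longrightarrow> w \<in> U \<Longrightarrow> le w x \<Longrightarrow> w \<in> D" "x \<in> D"
  shows "{w \<in> D. le w x} = {w \<in> U. le w x}"
  using assms by blast

text \<open>Removing the top of a tree changes neither the number of minimal elements nor, since the tree
  avoids the residue class of r, the strictness of the bound; this is why r appears on the right.\<close>

lemma forest_card_less: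
  fixes le :: "'a \<Rightarrow> 'a \<Rightarrow> bool" and l r :: nat
  assumes "finite U" "U \<noteq> {}" and r: "1 \<le> r" "r \<le> l"
    and "\<And>x. x \<in> U \<Longrightarrow> le x x"
    and "\<And>x y z. \<lbrakk>x \<in> U; y \<in> U; z \<in> U; le x y; le y z\<rbrakk> \<Longrightarrow> le x z"
    and "\<And>x y. \<lbrakk>x \<in> U; y \<in> U; le x y; le y x\<rbrakk> \<Longrightarrow> x = y"
    and "\<And>x y z. \<lbrakk>x \<in> U; y \<in> U; z \<in> U; le x y; le x z\<rbrakk> \<Longrightarrow> le y z \<or> le z y"
    and "\<And>x. x \<in> U \<Longrightarrow> card {w \<in> U. le w x} mod l \<noteq> r mod l"
  shows "card U + l < 2 * card (minimal_elements le U) * l + r"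
  using assms(1,2,5-)
proof (induction U rule: finite_psubset_induct)
  case (psubset U)
  note refl = psubset.prems(2) and trans = psubset.prems(3) and antisym = psubset.prems(4)
    and linear = psubset.prems(5) and avoid = psubset.prems(6)
  \<comment> \<open>The induction is only ever used on down-closed proper subsets: their minimal
    elements and principal down-sets are those inherited from \<open>U\<close>, so the residue
    condition survives the restriction.\<close>
  have IH: "card D + l < 2 * card (minimal_elements le U \<inter> D) * l + r"
    if D: "D \<subset> U" "D \<noteq> {}" and closed: "\<And>x w. x \<in> D \<Longrightarrow> w \<in> U \<Longrightarrow> le w x \<Longrightarrow> w \<in> D" for D
  proof -
    have sub: "D \<subseteq> U" using D by blast
    have "card D + l < 2 * card (minimal_elements le D) * l + r"
    proof (rule psubset.IH[OF D])
      show "card {w \<in> D. le w x} mod l \<noteq> r mod l" if "x \<in> D" for x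
        using principal_down_set_down_closed[OF sub, of le x] closed that avoid[of x] sub by auto
      show "le x x" if "x \<in> D" for x
        using refl that sub by blast
      show "le x z" if "x \<in> D" "y \<in> D" "z \<in> D" "le x y" "le y z" for x y z
        using trans[of x y z] that sub by blast
      show "x = y" if "x \<in> D" "y \<in> D" "le x y" "le y x" for x y
        using antisym[of x y] that sub by blast
      show "le y z \<or> le z y" if "x \<in> D" "y \<in> D" "z \<in> D" "le x y" "le x z" for x y z
        using linear[of x y z] that sub by blast
    qed
    then show ?thesis
      using minimal_elements_down_closed[OF sub, of le] closed by simp
  qed
  have "\<exists>u\<in>U. \<forall>x\<in>U. le u x \<longrightarrow> x = u"
  proof -
    define R where "R = {(x, y) \<in> U \<times> U. le x y \<and> x \<noteq> y}"
    have "trans R" "irrefl R"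
      unfolding R_def trans_def irrefl_def using trans antisym by blast+
    moreover have "finite R"
      unfolding R_def by (rule finite_subset[of _ "U \<times> U"]) (use psubset.hyps in auto)
    ultimately have "wf (R\<inverse>)"
      by (intro finite_acyclic_wf_converse) (auto simp: acyclic_irrefl)
    with \<open>U \<noteq> {}\<close> obtain u where "u \<in> U" "\<And>y. (y, u) \<in> R\<inverse> \<Longrightarrow> y \<notin> U"
      using wfE_min[of "R\<inverse>" _ U] by (metis ex_in_conv)
    then show ?thesis unfolding R_def by blast
  qed
  then obtain u where u: "u \<in> U" "\<And>x. x \<in> U \<Longrightarrow> le u x \<Longrightarrow> x = u" by blast
  have finM: "finite (minimal_elements le U)"
    using psubset.hyps by (simp add: minimal_elements_def)
  show ?case
  proof (cases "\<forall>x\<in>U. le x u")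
    case True
    show ?thesis
    proof (cases "U = {u}")
      case True
      then have "minimal_elements le U = {u}" by (auto simp: minimal_elements_def)
      \<comment> \<open>The bound reads \<open>1 + l < 2 * l + r\<close>, true because
        \<open>l\<close> and \<open>r\<close> are at least 1.\<close>
      then show ?thesis using True r by simp
    next
      case False
      let ?W = "U - {u}"
      have "card ?W + l < 2 * card (minimal_elements le U \<inter> ?W) * l + r"
        using u False by (intro IH) auto
      \<comment> \<open>The root \<open>u\<close> lies above another element, so it is not minimal;
        it lies below no other, so removing it creates no new minimal element.\<close>
      moreover have "minimal_elements le U \<inter> ?W = minimal_elements le U"
        using False True u unfolding minimal_elements_def by fast
      moreover have "card U = card ?W + 1"
        using psubset.hyps u by (metis Suc_eq_plus1 card_Suc_Diff1)
      ultimately have le: "card U + l \<le> 2 * card (minimal_elements le U) * l + r" by simp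
      have "card U mod l \<noteq> r mod l"
        using avoid[OF u(1)] True by (metis (mono_tags, lifting) Collect_cong Collect_mem_eq)
      moreover have "card U mod l = r mod l" if "card U + l = 2 * card (minimal_elements le U) * l + r"
        using arg_cong[OF that, of "\<lambda>x. x mod l"] by simp
      ultimately show ?thesis using le by linarith
    qed
  next
    case False
    let ?D = "{x \<in> U. le x u}"
    have "card ?D + l < 2 * card (minimal_elements le U \<inter> ?D) * l + r"
      using False u refl trans by (intro IH) blast+
    moreover have "card (U - ?D) + l < 2 * card (minimal_elements le U \<inter> (U - ?D)) * l + r"
    proof (intro IH)
      show "U - ?D \<subset> U" using u refl by blast
      show "U - ?D \<noteq> {}" using False by blast
      fix x w assume x: "x \<in> U - ?D" and w: "w \<in> U" "le w x"
      \<comment> \<open>Otherwise \<open>x\<close> and \<open>u\<close> both lie above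
        \<open>w\<close>, hence are comparable: \<open>le x u\<close> is excluded, and
        \<open>le u x\<close> gives \<open>x = u\<close> by maximality of \<open>u\<close>.\<close>
      have "\<not> le w u"
        using linear[of w x u] x w u by blast
      then show "w \<in> U - ?D" using w by blast
    qed
    moreover have "card U = card ?D + card (U - ?D)"
      using psubset.hyps by (subst card_Un_disjoint[symmetric]) (auto intro: arg_cong[where f = card])
    moreover have "card (minimal_elements le U)
        = card (minimal_elements le U \<inter> ?D) + card (minimal_elements le U \<inter> (U - ?D))"
      using finM
      by (subst card_Un_disjoint[symmetric])
        (auto intro!: arg_cong[where f = card] simp: minimal_elements_def)
    \<comment> \<open>The two strict bounds are added; as \<open>r \<le> l\<close>, the extra
      \<open>l\<close> on the left pays for the extra \<open>r\<close> on the right.\<close>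
    ultimately have "card U + 2 * l < 2 * card (minimal_elements le U) * l + 2 * r"
      by (simp add: algebra_simps)
    then show ?thesis using r by simp
  qed
qed

section \<open>Pigeonhole on residues; independence and hitting numbers of finite graphs\<close>

text \<open>The \<open>l\<close> residue classes are disjoint, so they cannot all exceed the average
  size. Residue 0 is represented by \<open>l\<close>, because \<open>forest_card_less\<close> needs
  \<open>1 \<le> r\<close>.\<close>

lemma exists_residue_small:
  fixes f :: "'a \<Rightarrow> nat"
  assumes "finite V" "l \<ge> 1"
  shows "\<exists>r\<in>{1..l}. l * card {v \<in> V. f v mod l = r mod l} \<le> card V"
proof (rule ccontr)
  assume "\<not> ?thesis"
  then have big: "card V < l * card {v \<in> V. f v mod l = r mod l}" if "r \<in> {1..l}" for r
    using that by (meson not_le)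
  have inj: "r = r'" if "r \<in> {1..l}" "r' \<in> {1..l}" "r mod l = r' mod l" for r r'
    using that by (cases "r = l"; cases "r' = l") auto
  have "l * card V = (\<Sum>r\<in>{1..l}. card V)" by simp
  also have "\<dots> < (\<Sum>r\<in>{1..l}. l * card {v \<in> V. f v mod l = r mod l})"
    using assms big by (intro sum_strict_mono) auto
  also have "\<dots> = l * card (\<Union>r\<in>{1..l}. {v \<in> V. f v mod l = r mod l})"
    using assms inj
    by (subst card_UN_disjoint) (auto simp: sum_distrib_left dest: inj)
  also have "\<dots> \<le> l * card V"
    using assms by (intro mult_left_mono card_mono) auto
  finally show False by simp
qed

lemma independent_set_finite:
  "\<lbrakk>finite (pverts G); independent_set G S\<rbrakk> \<Longrightarrow> finite S"
  by (auto simp: independent_set_def intro: finite_subset)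

lemma independence_number_ge:
  assumes "finite (pverts G)" "independent_set G S"
  shows "card S \<le> independence_number G"
  unfolding independence_number_def
proof (rule Max_ge)
  show "finite (card ` {S. independent_set G S})"
    by (rule finite_imageI, rule finite_subset[of _ "Pow (pverts G)"])
      (use assms in \<open>auto simp: independent_set_def\<close>)
qed (use assms in auto)

lemma hitting_number_le:
  assumes "finite (pverts G)" "hitting_set G T"
  shows "hitting_number G \<le> card T"
  unfolding hitting_number_def
proof (rule Min_le)
  show "finite (card ` {T. hitting_set G T})"
    by (rule finite_imageI, rule finite_subset[of _ "Pow (pverts G)"])
      (use assms in \<open>auto simp: hitting_set_def\<close>)
qed (use assms in auto)

section \<open>Interval overlap graphs\<close>

text \<open>Intervals may share endpoints; the strict inequalities match the convention that chords
  meeting only on the circle do not cross. \<open>interval_inj\<close> makes enclosure antisymmetric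
  on vertices.\<close>

locale interval_overlap_graph =
  fixes G :: "'a pair_pre_digraph" and lo hi :: "'a \<Rightarrow> real"
  assumes finite_verts: "finite (pverts G)"
    and lo_less_hi: "v \<in> pverts G \<Longrightarrow> lo v < hi v"
    and interval_inj: "\<lbrakk>u \<in> pverts G; v \<in> pverts G; lo u = lo v; hi u = hi v\<rbrakk> \<Longrightarrow> u = v"
    and arcs_iff: "\<lbrakk>u \<in> pverts G; v \<in> pverts G\<rbrakk> \<Longrightarrow> (u, v) \<in> parcs G \<longleftrightarrow>
      lo u < lo v \<and> lo v < hi u \<and> hi u < hi v \<or> lo v < lo u \<and> lo u < hi v \<and> hi v < hi u"
begin

definition encl :: "'a \<Rightarrow> 'a \<Rightarrow> bool" where
  "encl u v \<longleftrightarrow> lo v \<le> lo u \<and> hi u \<le> hi v"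

text \<open>The independence number of the subgraph induced by the intervals inside
  \<open>v\<close>, with \<open>v\<close> itself included.\<close>

definition inner_alpha :: "'a \<Rightarrow> nat" where
  "inner_alpha v = Max (card ` {I. independent_set G I \<and> (\<forall>w\<in>I. encl w v)})"

text \<open>Swapping the part of \<open>S\<close> inside \<open>v\<close> for any independent
  \<open>I\<close> inside \<open>v\<close> leaves an independent set. Since \<open>S\<close> is
  maximum, \<open>I\<close> cannot be larger than the part it replaces.\<close>

lemma exchange:
  assumes S: "maximum_independent_set G S" and v: "v \<in> S"
  shows "card {w \<in> S. encl w v} = inner_alpha v"
  unfolding inner_alpha_def
proof (rule Max_eqI[symmetric])
  have indS: "independent_set G S" and cardS: "card S = independence_number G"
    using S by (auto simp: maximum_independent_set_def)
  have SV: "S \<subseteq> pverts G" using indS by (simp add: independent_set_def)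
  show "finite (card ` {I. independent_set G I \<and> (\<forall>w\<in>I. encl w v)})"
    by (rule finite_imageI, rule finite_subset[of _ "Pow (pverts G)"])
      (use finite_verts in \<open>auto simp: independent_set_def\<close>)
  show "card {w \<in> S. encl w v} \<in> card ` {I. independent_set G I \<and> (\<forall>w\<in>I. encl w v)}"
    using indS by (intro imageI) (auto simp: independent_set_def)
  fix y assume "y \<in> card ` {I. independent_set G I \<and> (\<forall>w\<in>I. encl w v)}"
  then obtain I where I: "independent_set G I" "\<And>w. w \<in> I \<Longrightarrow> encl w v" "y = card I" by auto
  let ?B = "{w \<in> S. encl w v}"
  have IV: "I \<subseteq> pverts G" using I by (simp add: independent_set_def)
  \<comment> \<open>A member \<open>w\<close> of \<open>S\<close> not inside \<open>v\<close> and
    not crossing \<open>v\<close> either contains \<open>v\<close> or has interior disjoint from it;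
    either way it crosses nothing inside \<open>v\<close>.\<close>
  have nocross: "(i, w) \<notin> parcs G \<and> (w, i) \<notin> parcs G" if i: "i \<in> I" and w: "w \<in> S - ?B" for i w
  proof -
    have V: "i \<in> pverts G" "w \<in> pverts G" "v \<in> pverts G" using i w v SV IV by auto
    have "(w, v) \<notin> parcs G" "\<not> encl w v" "encl i v"
      using w v i I indS by (auto simp: independent_set_def)
    then show ?thesis
      using lo_less_hi[OF V(1)] lo_less_hi[OF V(2)] lo_less_hi[OF V(3)]
      unfolding arcs_iff[OF V(2,3)] arcs_iff[OF V(1,2)] arcs_iff[OF V(2,1)] encl_def
      by linarith
  qed
  have "independent_set G ((S - ?B) \<union> I)"
    using I indS nocross unfolding independent_set_def by blast
  then have "card ((S - ?B) \<union> I) \<le> card S"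
    using independence_number_ge finite_verts cardS by metis
  moreover have "(S - ?B) \<inter> I = {}" using I by auto
  moreover have fin: "finite S" "finite I" using SV IV finite_verts finite_subset by blast+
  moreover have "card S = card (S - ?B) + card ?B"
    using fin by (subst card_Un_disjoint[symmetric]) (auto intro: arg_cong[where f = card])
  ultimately show "y \<le> card ?B" using I(3) by (simp add: card_Un_disjoint)
qed

text \<open>Enclosure makes \<open>S\<close> a forest, and \<open>exchange\<close> identifies the
  sizes of its principal down-sets with \<open>inner_alpha\<close>, so
  \<open>forest_card_less\<close> applies.\<close>

lemma independent_set_avoiding_residue:
  assumes S: "maximum_independent_set G S" "S \<noteq> {}" and r: "1 \<le> r" "r \<le> l"
    and avoid: "\<And>v. v \<in> S \<Longrightarrow> inner_alpha v mod l \<noteq> r mod l"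
  shows "card S < 2 * card (minimal_elements encl S) * l"
proof -
  have indS: "independent_set G S" using S by (auto simp: maximum_independent_set_def)
  then have SV: "S \<subseteq> pverts G" by (simp add: independent_set_def)
  have "card S + l < 2 * card (minimal_elements encl S) * l + r"
  proof (rule forest_card_less[OF _ \<open>S \<noteq> {}\<close> r])
    show "finite S" using SV finite_verts finite_subset by blast
    show "x = y" if "x \<in> S" "y \<in> S" "encl x y" "encl y x" for x y
      using that SV by (intro interval_inj) (auto simp: encl_def)
    show "encl y z \<or> encl z y" if "x \<in> S" "y \<in> S" "z \<in> S" "encl x y" "encl x z" for x y z
    \<comment> \<open>Both \<open>y\<close> and \<open>z\<close> contain the nondegenerate interval
      \<open>x\<close>; two overlapping intervals that do not cross are nested.\<close>
    proof -
      have V: "x \<in> pverts G" "y \<in> pverts G" "z \<in> pverts G" using that SV by auto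
      have "(y, z) \<notin> parcs G" using that indS by (auto simp: independent_set_def)
      then show ?thesis
        using lo_less_hi[OF V(1)] that(4,5) unfolding arcs_iff[OF V(2,3)] encl_def by linarith
    qed
    show "card {w \<in> S. encl w x} mod l \<noteq> r mod l" if "x \<in> S" for x
      using exchange[OF S(1) that] avoid[OF that] by simp
  qed (auto simp: encl_def)
  then show ?thesis using r by simp
qed

definition closed_nbhd :: "'a \<Rightarrow> 'a set" where
  "closed_nbhd v = insert v {w \<in> pverts G. (v, w) \<in> parcs G}"

text \<open>A maximum independent set missing \<open>v\<close> and all its neighbours could be
  enlarged by \<open>v\<close>.\<close>

lemma closed_nbhd_hitting:
  assumes v: "v \<in> pverts G"
  shows "hitting_set G (closed_nbhd v)"
  unfolding hitting_set_def
proof (intro conjI allI impI)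
  show "closed_nbhd v \<subseteq> pverts G" using v by (auto simp: closed_nbhd_def)
  fix S assume "maximum_independent_set G S"
  then have S: "independent_set G S" "card S = independence_number G"
    by (auto simp: maximum_independent_set_def)
  show "closed_nbhd v \<inter> S \<noteq> {}"
  proof
    assume disj: "closed_nbhd v \<inter> S = {}"
    have SV: "S \<subseteq> pverts G" using S by (auto simp: independent_set_def)
    have no: "(v, w) \<notin> parcs G" "(w, v) \<notin> parcs G" if "w \<in> S" for w
      using disj that SV v arcs_iff[of v w] arcs_iff[of w v] by (auto simp: closed_nbhd_def)
    have "(v, v) \<notin> parcs G" using v arcs_iff[of v v] by auto
    with no have "independent_set G (insert v S)"
      using S(1) v unfolding independent_set_def by blast
    then have "card (insert v S) \<le> card S"
      using independence_number_ge finite_verts S(2) by metis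
    moreover have "v \<notin> S" using disj by (auto simp: closed_nbhd_def)
    ultimately show False using independent_set_finite[OF finite_verts S(1)] by simp
  qed
qed

lemma minimal_interiors_disjoint:
  assumes S: "independent_set G S"
    and u: "u \<in> minimal_elements encl S" and v: "v \<in> minimal_elements encl S"
    and t: "lo u < t" "t < hi u" "lo v < t" "t < hi v"
  shows "u = v"
proof -
  have "u \<in> S" "v \<in> S" using u v by (auto simp: minimal_elements_def)
  then have V: "u \<in> pverts G" "v \<in> pverts G" and "(u, v) \<notin> parcs G"
    using S by (auto simp: independent_set_def)
  then have "encl u v \<or> encl v u"
    using t unfolding arcs_iff[OF V] encl_def by linarith
  then show ?thesis using u v by (auto simp: minimal_elements_def)
qed

text \<open>Every neighbour of \<open>v\<close> has an endpoint strictly inside \<open>v\<close>.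
  The minimal intervals have disjoint interiors, so each of the \<open>2 * card (pverts G)\<close>
  endpoints is counted at most once in the sum of their degrees; a minimal interval of least degree
  then works.\<close>

lemma minimal_small_degree:
  assumes S: "independent_set G S" and ne: "minimal_elements encl S \<noteq> {}"
  shows "\<exists>v\<in>minimal_elements encl S.
    card (minimal_elements encl S) * card {w \<in> pverts G. (v, w) \<in> parcs G} \<le> 2 * card (pverts G)"
proof -
  let ?M = "minimal_elements encl S" and ?V = "pverts G"
  \<comment> \<open>Used with \<open>t\<close> equal to \<open>lo\<close> and to \<open>hi\<close>,
    so that left and right endpoints are counted separately.\<close>
  let ?A = "\<lambda>t v. {w \<in> ?V. lo v < t w \<and> t w < hi v}"
  have MV: "?M \<subseteq> ?V" using S by (auto simp: independent_set_def minimal_elements_def)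
  then have finM: "finite ?M" using finite_verts finite_subset by blast
  have count: "(\<Sum>v\<in>?M. card (?A t v)) \<le> card ?V" for t
  proof -
    have "(\<Sum>v\<in>?M. card (?A t v)) = card (\<Union>v\<in>?M. ?A t v)"
    proof (rule card_UN_disjoint[symmetric])
      show "\<forall>u\<in>?M. \<forall>v\<in>?M. u \<noteq> v \<longrightarrow> ?A t u \<inter> ?A t v = {}"
        using minimal_interiors_disjoint[OF S] by blast
    qed (use finM finite_verts in auto)
    also have "\<dots> \<le> card ?V" using finite_verts by (intro card_mono) auto
    finally show ?thesis .
  qed
  have "card {w \<in> ?V. (v, w) \<in> parcs G} \<le> card (?A lo v) + card (?A hi v)" if "v \<in> ?M" for v
  proof -
    have "card {w \<in> ?V. (v, w) \<in> parcs G} \<le> card (?A lo v \<union> ?A hi v)"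
      using finite_verts MV that by (intro card_mono) (auto simp: arcs_iff)
    then show ?thesis using card_Un_le le_trans by blast
  qed
  then have "(\<Sum>v\<in>?M. card {w \<in> ?V. (v, w) \<in> parcs G}) \<le> (\<Sum>v\<in>?M. card (?A lo v) + card (?A hi v))"
    by (intro sum_mono)
  also have "\<dots> \<le> 2 * card ?V" using count[of lo] count[of hi] by (simp add: sum.distrib)
  finally have total: "(\<Sum>v\<in>?M. card {w \<in> ?V. (v, w) \<in> parcs G}) \<le> 2 * card ?V" .
  obtain v where v: "v \<in> ?M" "\<And>x. x \<in> ?M \<Longrightarrow>
      card {w \<in> ?V. (v, w) \<in> parcs G} \<le> card {w \<in> ?V. (x, w) \<in> parcs G}"
    using ex_min_if_finite[of "(\<lambda>v. card {w \<in> ?V. (v, w) \<in> parcs G}) ` ?M"] finM ne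
    by (auto simp: not_less)
  have "card ?M * card {w \<in> ?V. (v, w) \<in> parcs G} \<le> (\<Sum>v\<in>?M. card {w \<in> ?V. (v, w) \<in> parcs G})"
    using sum_bounded_below[of ?M "card {w \<in> ?V. (v, w) \<in> parcs G}"] v(2) by simp
  with total v(1) show ?thesis by (intro bexI[of _ v]) linarith+
qed

section \<open>The square root bound for interval overlap graphs\<close>

text \<open>The constant adds up the separate cases: many minimal intervals give 3, the remaining
  two cases give \<open>4 / c\<close>.\<close>

lemma hitting_number_bound:
  fixes c :: real
  assumes c: "c > 0" and n: "card (pverts G) = n" "n \<ge> 1"
    and alpha: "real (independence_number G) = c * real n"
  shows "real (hitting_number G) \<le> (3 + 4 / c) * sqrt (real n)"
proof -
  let ?s = "sqrt (real n)"
  have s: "?s \<ge> 1" "?s * ?s = real n" using n by auto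
  \<comment> \<open>The independence number is positive, so no maximum independent set is
    empty.\<close>
  have "hitting_set G (pverts G)"
    using alpha c n
    by (auto simp: hitting_set_def maximum_independent_set_def independent_set_def Int_absorb1)
  then have "hitting_number G \<le> n" using hitting_number_le finite_verts n by blast
  then have trivial: "real (hitting_number G) \<le> ?s * ?s" using s by simp
  \<comment> \<open>The first case is the one where the modulus \<open>l\<close> chosen below would
    be 0; there the trivial bound \<open>n\<close> suffices.\<close>
  consider "c * ?s / 2 < 1"
    | S where "maximum_independent_set G S" "?s \<le> real (card (minimal_elements encl S))"
    | "c * ?s / 2 \<ge> 1" "\<And>S. maximum_independent_set G S \<Longrightarrow> real (card (minimal_elements encl S)) < ?s"
    by (meson not_le)
  then show ?thesis
  proof cases
    case 1
    have "c * real (hitting_number G) \<le> c * ?s * ?s" using trivial c by simp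
    also have "\<dots> \<le> 4 * ?s" using 1 s by (intro mult_right_mono) auto
    finally have "real (hitting_number G) \<le> 4 / c * ?s" using c by (simp add: field_simps)
    also have "\<dots> \<le> (3 + 4 / c) * ?s" using c s by (intro mult_right_mono) auto
    finally show ?thesis .
  next
    case 2
    then have S: "independent_set G S" "?s \<le> real (card (minimal_elements encl S))"
      by (auto simp: maximum_independent_set_def)
    then have "minimal_elements encl S \<noteq> {}" using s by auto
    from minimal_small_degree[OF S(1) this] obtain v where v: "v \<in> minimal_elements encl S"
      "card (minimal_elements encl S) * card {w \<in> pverts G. (v, w) \<in> parcs G} \<le> 2 * n"
      using n by auto
    let ?d = "card {w \<in> pverts G. (v, w) \<in> parcs G}"
    have "?s * real ?d \<le> real (card (minimal_elements encl S)) * real ?d"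
      using S by (intro mult_right_mono) auto
    also have "\<dots> \<le> 2 * (?s * ?s)"
      unfolding s(2) using of_nat_mono[OF v(2), where 'a = real] by simp
    also have "\<dots> = ?s * (2 * ?s)" by simp
    finally have d: "real ?d \<le> 2 * ?s"
      using s by (simp only: mult_le_cancel_left_pos)
    have "v \<in> pverts G" using v S by (auto simp: minimal_elements_def independent_set_def)
    then have "hitting_number G \<le> card (closed_nbhd v)"
      using closed_nbhd_hitting hitting_number_le finite_verts by blast
    also have "\<dots> \<le> Suc ?d" unfolding closed_nbhd_def by (rule card_insert_le_m1) auto
    \<comment> \<open>The vertex \<open>v\<close> itself contributes 1, which is at most
      \<open>?s\<close>.\<close>
    finally have "real (hitting_number G) \<le> 3 * ?s" using d s by linarith
    also have "\<dots> \<le> (3 + 4 / c) * ?s" using c s by (intro mult_right_mono) auto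
    finally show ?thesis .
  next
    case 3
    note large = 3(1) and few_minimal = 3(2)
    \<comment> \<open>The largest \<open>l\<close> with \<open>2 * ?s * l \<le> c * n\<close>, as
      the final contradiction requires. Rounding down a number that is at least 1 loses at most half
      of it, whence \<open>c * ?s / 4 \<le> l\<close>.\<close>
    define l where "l = nat \<lfloor>c * ?s / 2\<rfloor>"
    have "real l \<le> c * ?s / 2" "c * ?s / 2 < real l + 1" "l \<ge> 1"
      using large by (auto simp: l_def le_nat_floor le_floor_iff) (linarith+)?
    then have l: "c * ?s / 4 \<le> real l" "real l \<le> c * ?s / 2" "l \<ge> 1"
      by auto
    obtain r where r: "1 \<le> r" "r \<le> l"
      and small: "l * card {v \<in> pverts G. inner_alpha v mod l = r mod l} \<le> n"
      using exists_residue_small[OF finite_verts l(3), of inner_alpha] n(1) by auto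
    let ?T = "{v \<in> pverts G. inner_alpha v mod l = r mod l}"
    have "hitting_set G ?T"
      unfolding hitting_set_def
    proof (intro conjI allI impI notI)
      fix S assume S: "maximum_independent_set G S" and disj: "?T \<inter> S = {}"
      have SV: "S \<subseteq> pverts G" and cardS: "real (card S) = c * real n"
        using S alpha by (auto simp: maximum_independent_set_def independent_set_def)
      have "S \<noteq> {}" using cardS c n by auto
      then have "card S < 2 * card (minimal_elements encl S) * l"
        using r disj SV by (intro independent_set_avoiding_residue[OF S]) auto
      have "finite S" using SV finite_verts finite_subset by blast
      have "c * real n = real (card S)" using cardS by simp
      also have "\<dots> < real (2 * card (minimal_elements encl S) * l)"
        using \<open>card S < _\<close> by (rule of_nat_less_iff[THEN iffD2])
      also have "\<dots> = 2 * real (card (minimal_elements encl S)) * real l" by simp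
      also have "\<dots> \<le> 2 * ?s * (c * ?s / 2)"
        using few_minimal[OF S] l(2) s by (intro mult_mono) auto
      also have "\<dots> = c * real n" using s by (simp add: mult_ac)
      finally show False by simp
    qed auto
    then have "hitting_number G \<le> card ?T" using hitting_number_le finite_verts by blast
    then have "c * ?s / 4 * real (hitting_number G) \<le> real l * real (card ?T)"
      using l c s by (intro mult_mono) auto
    also have "\<dots> \<le> real n" using of_nat_mono[OF small, where 'a = real] by simp
    finally have "c / 4 * real (hitting_number G) * ?s \<le> ?s * ?s" using s by (simp add: mult_ac)
    then have "c / 4 * real (hitting_number G) \<le> ?s"
      using s by (metis mult_right_le_imp_le order_less_le_trans zero_less_one)
    then have "real (hitting_number G) \<le> 4 / c * ?s" using c by (simp add: field_simps)
    also have "\<dots> \<le> (3 + 4 / c) * ?s" using c s by (intro mult_right_mono) auto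
    finally show ?thesis .
  qed
qed

end

section \<open>Chords in angular coordinates\<close>

definition circle_point :: "complex \<Rightarrow> real \<Rightarrow> real \<Rightarrow> complex" where
  "circle_point z r t = z + of_real r * cis t"

text \<open>Twice the signed area of the triangle \<open>a\<close>, \<open>b\<close>,
  \<open>x\<close>. For distinct \<open>a\<close> and \<open>b\<close> it vanishes exactly on their
  line, and its sign tells the two sides apart.\<close>

definition side :: "complex \<Rightarrow> complex \<Rightarrow> complex \<Rightarrow> real" where
  "side a b x = Im ((x - a) * cnj (b - a))"

lemma side_affine: "side a b (c + of_real m * (d - c)) = (1 - m) * side a b c + m * side a b d"
  by (simp add: side_def algebra_simps)

text \<open>The signed area of an inscribed triangle factors into sines of half the angle
  differences, so its sign can be read off from the order of the angles.\<close>

lemma side_circle_point: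
  "side (circle_point z r s) (circle_point z r t) (circle_point z r u)
    = 4 * r\<^sup>2 * sin ((u - t) / 2) * sin ((s - u) / 2) * sin ((s - t) / 2)"
proof -
  have triple: "sin (2 * x) + sin (2 * y) - sin (2 * (x + y)) = 4 * sin x * sin y * sin (x + y)" for x y :: real
  proof -
    have c: "cos x ^ 2 = 1 - sin x ^ 2" "cos y ^ 2 = 1 - sin y ^ 2"
      by (simp_all add: cos_squared_eq)
    have "sin (2 * x) + sin (2 * y) - sin (2 * (x + y))
      = 2 * sin x * cos x + 2 * sin y * cos y
        - 2 * (sin x * cos y + cos x * sin y) * (cos x * cos y - sin x * sin y)"
      by (simp only: sin_double sin_add cos_add)
    \<comment> \<open>A polynomial identity modulo the two Pythagorean relations
      \<open>c\<close>.\<close>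
    also have "\<dots> = 4 * sin x * sin y * (sin x * cos y + cos x * sin y)"
      using c by algebra
    finally show ?thesis by (simp only: sin_add)
  qed
  have "side (circle_point z r s) (circle_point z r t) (circle_point z r u)
    = r\<^sup>2 * (sin (u - t) + sin (s - u) - sin (s - t))"
    by (simp add: side_def circle_point_def sin_diff algebra_simps power2_eq_square)
  also have "sin (u - t) + sin (s - u) - sin (s - t)
    = 4 * sin ((u - t) / 2) * sin ((s - u) / 2) * sin ((s - t) / 2)"
    proof -
    have eq: "(u - t) / 2 + (s - u) / 2 = (s - t) / 2" by (simp add: field_simps)
    have half: "2 * (x / 2) = x" for x :: real by simp
    show ?thesis
      using triple[of "(u - t) / 2" "(s - u) / 2"] unfolding eq half .
  qed
  finally show ?thesis by simp
qed

text \<open>The half angle lies strictly between \<open>-pi\<close> and \<open>pi\<close>, where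
  sine has the sign of its argument.\<close>

lemma sgn_sin_half:
  fixes x :: real
  assumes "\<bar>x\<bar> < 2 * pi"
  shows "sgn (sin (x / 2)) = sgn x"
proof (cases x "0 :: real" rule: linorder_cases)
  case less
  then have "sin (- x / 2) > 0" using assms by (intro sin_gt_zero) auto
  then show ?thesis using less by simp
next
  case greater
  then have "sin (x / 2) > 0" using assms by (intro sin_gt_zero) auto
  then show ?thesis using greater by simp
qed simp

lemma sgn_side_circle_point:
  assumes "r > 0" "0 \<le> s" "s < t" "t < 2 * pi" "0 \<le> u" "u < 2 * pi"
  shows "sgn (side (circle_point z r s) (circle_point z r t) (circle_point z r u))
    = sgn (u - s) * sgn (u - t)"
proof -
  have "sgn (sin ((u - t) / 2)) = sgn (u - t)" "sgn (sin ((s - u) / 2)) = sgn (s - u)"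
    "sgn (sin ((s - t) / 2)) = sgn (s - t)"
    using assms by (intro sgn_sin_half; simp add: abs_less_iff)+
  then show ?thesis
    using assms by (simp add: side_circle_point sgn_mult) (simp add: sgn_if)
qed

text \<open>This is the power of a point on the secant through \<open>a\<close> and
  \<open>b\<close>.\<close>

lemma norm_line_minus_center:
  fixes a b z :: complex
  assumes "norm (a - z) = r" "norm (b - z) = r"
  shows "(norm (a + of_real m * (b - a) - z))\<^sup>2 = r\<^sup>2 - m * (1 - m) * (norm (b - a))\<^sup>2"
proof -
  have "(Re a - Re z)\<^sup>2 + (Im a - Im z)\<^sup>2 = r\<^sup>2" "(Re b - Re z)\<^sup>2 + (Im b - Im z)\<^sup>2 = r\<^sup>2"
    using assms by (auto simp: cmod_power2[symmetric] simp flip: minus_complex.simps)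
  then show ?thesis
    by (simp add: cmod_power2) algebra
qed

lemma line_in_ball_iff:
  fixes a b z :: complex
  assumes "a \<in> sphere z r" "b \<in> sphere z r" "a \<noteq> b"
  shows "a + of_real m * (b - a) \<in> ball z r \<longleftrightarrow> 0 < m \<and> m < 1"
proof -
  have n: "norm (a - z) = r" "norm (b - z) = r"
    using assms by (auto simp: dist_norm norm_minus_commute)
  have "r \<ge> 0" using n(1) norm_ge_zero by metis
  have "a + of_real m * (b - a) \<in> ball z r \<longleftrightarrow> norm (a + of_real m * (b - a) - z) < r"
    by (simp add: dist_norm norm_minus_commute)
  also have "\<dots> \<longleftrightarrow> (norm (a + of_real m * (b - a) - z))\<^sup>2 < r\<^sup>2"
    using \<open>r \<ge> 0\<close> by (metis norm_ge_zero power2_less_imp_less power_strict_mono zero_less_numeral)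
  also have "\<dots> \<longleftrightarrow> m * (1 - m) > 0"
    unfolding norm_line_minus_center[OF n] using assms by (simp add: zero_less_mult_iff)
  finally show ?thesis by (auto simp: zero_less_mult_iff)
qed

text \<open>The quotient \<open>(x - a) / (b - a)\<close> has imaginary part 0, and its real value
  is the parameter \<open>m\<close>.\<close>

lemma side_eq_0_imp_line:
  assumes "side a b x = 0" "a \<noteq> b"
  obtains m where "x = a + of_real m * (b - a)"
proof -
  have "(x - a) / (b - a) = (x - a) * cnj (b - a) / of_real ((norm (b - a))\<^sup>2)"
    by (rule complex_div_cnj)
  also have "Im \<dots> = 0" using assms(1) unfolding Im_divide_of_real side_def by simp
  finally have "(x - a) / (b - a) = of_real (Re ((x - a) / (b - a)))"
    by (simp add: complex_eq_iff)
  then have "x = a + of_real (Re ((x - a) / (b - a))) * (b - a)"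
    using assms(2) by (simp add: field_simps)
  then show ?thesis using that by blast
qed

lemma closed_segment_line:
  "x \<in> closed_segment a b \<longleftrightarrow> (\<exists>m. 0 \<le> m \<and> m \<le> 1 \<and> x = a + of_real m * (b - a))"
  for a b :: complex
  by (auto simp: in_segment scaleR_conv_of_real algebra_simps)

lemma side_closed_segment: "x \<in> closed_segment a b \<Longrightarrow> side a b x = 0"
proof -
  assume "x \<in> closed_segment a b"
  then obtain m where "x = a + of_real m * (b - a)" using closed_segment_line by blast
  moreover have "side a b a = 0" "side a b b = 0" by (simp_all add: side_def algebra_simps)
  ultimately show ?thesis by (simp add: side_affine)
qed

lemma circle_point_in_sphere: "r > 0 \<Longrightarrow> circle_point z r t \<in> sphere z r"
  by (simp add: circle_point_def dist_norm norm_mult)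

lemma sphere_circle_point:
  assumes "x \<in> sphere z r"
  obtains t where "0 \<le> t" "t < 2 * pi" "x = circle_point z r t"
proof
  \<comment> \<open>\<open>Arg2pi\<close> takes values in \<open>[0, 2 * pi)\<close>, which cuts the
    circle open at angle 0.\<close>
  show "0 \<le> Arg2pi (x - z)" "Arg2pi (x - z) < 2 * pi"
    using Arg2pi by blast+
  have "x - z = of_real (norm (x - z)) * exp (\<i> * of_real (Arg2pi (x - z)))"
    using Arg2pi by (metis is_Arg_def)
  then show "x = circle_point z r (Arg2pi (x - z))"
    using assms by (simp add: circle_point_def cis_conv_exp dist_norm norm_minus_commute algebra_simps)
qed

lemma chord_arc:
  assumes "chord_of_circle z r u"
  obtains s t where "0 \<le> s" "s < t" "t < 2 * pi"
    "u = closed_segment (circle_point z r s) (circle_point z r t)"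
proof -
  obtain a b where ab: "a \<in> sphere z r" "b \<in> sphere z r" "a \<noteq> b" "u = closed_segment a b"
    using assms by (auto simp: chord_of_circle_def)
  obtain s t where "0 \<le> s" "s < 2 * pi" "a = circle_point z r s"
    "0 \<le> t" "t < 2 * pi" "b = circle_point z r t"
    using sphere_circle_point ab by metis
  with ab that[of s t] that[of t s] show thesis
    by (cases s t rule: linorder_cases) (auto simp: closed_segment_commute)
qed

text \<open>Chords cross iff the endpoints of one lie strictly on opposite sides of the line of the
  other; \<open>sgn_side_circle_point\<close> translates this into interleaving of angles.\<close>

lemma chords_cross_iff:
  assumes r: "r > 0" and st: "0 \<le> s" "s < t" "t < 2 * pi" and st': "0 \<le> s'" "s' < t'" "t' < 2 * pi"
    and u: "u = closed_segment (circle_point z r s) (circle_point z r t)"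
    and v: "v = closed_segment (circle_point z r s') (circle_point z r t')"
  shows "chords_cross z r u v \<longleftrightarrow> s < s' \<and> s' < t \<and> t < t' \<or> s' < s \<and> s < t' \<and> t' < t"
    (is "_ \<longleftrightarrow> ?interleaved")
proof -
  let ?P = "circle_point z r"
  let ?f = "side (?P s) (?P t)"
  have sgn_f: "sgn (?f (?P x)) = sgn (x - s) * sgn (x - t)" if "0 \<le> x" "x < 2 * pi" for x
    using sgn_side_circle_point r st that by blast
  have sgns: "sgn (?f (?P s')) = sgn (s' - s) * sgn (s' - t)" "sgn (?f (?P t')) = sgn (t' - s) * sgn (t' - t)"
    using st' by (auto intro!: sgn_f)
  have ne: "?P s \<noteq> ?P t" "?P s' \<noteq> ?P t'"
  proof -
    have neq: "?P a \<noteq> ?P b" if "0 \<le> a" "a < b" "b < 2 * pi" for a b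
    proof
      assume eq: "?P a = ?P b"
      \<comment> \<open>A third angle, different from \<open>a\<close> and \<open>b\<close>: were
        the two points equal, \<open>side\<close> would vanish there too.\<close>
      define w where "w = (if a = 0 then (b + 2 * pi) / 2 else a / 2)"
      have w: "0 \<le> w" "w < 2 * pi" "w \<noteq> a" "w \<noteq> b" using that by (auto simp: w_def)
      have "sgn (side (?P a) (?P b) (?P w)) \<noteq> 0"
        using sgn_side_circle_point[of r a b w z] r that w by (simp add: sgn_0_0)
      then show False using eq by (simp add: side_def)
    qed
    show "?P s \<noteq> ?P t" "?P s' \<noteq> ?P t'" using neq st st' by auto
  qed
  note sphere = circle_point_in_sphere[OF r, of z]
  show ?thesis
  proof
    assume "chords_cross z r u v"
    then obtain x where x: "x \<in> u" "x \<in> v" "x \<in> ball z r" and "u \<noteq> v"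
      by (auto simp: chords_cross_def)
    obtain m where m: "x = ?P s' + of_real m * (?P t' - ?P s')"
      using x(2) v closed_segment_line by blast
    then have m01: "0 < m" "m < 1"
      using line_in_ball_iff[OF sphere sphere ne(2), of m] x(3) by auto
    have zero: "(1 - m) * ?f (?P s') + m * ?f (?P t') = 0"
      using side_closed_segment[of x "?P s" "?P t"] x(1) u m by (simp add: side_affine)
    show ?interleaved
    proof (rule ccontr)
      assume "\<not> ?interleaved"
      \<comment> \<open>Both endpoints of \<open>v\<close> lie weakly on one side of
        \<open>u\<close>. A convex combination with positive weights vanishes at \<open>x\<close>,
        so both values are 0; then the two chords share both endpoints.\<close>
      then have "sgn (?f (?P s')) \<ge> 0 \<and> sgn (?f (?P t')) \<ge> 0 \<or> sgn (?f (?P s')) \<le> 0 \<and> sgn (?f (?P t')) \<le> 0"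
        unfolding sgns using st st' by (auto simp: sgn_if)
      then have "?f (?P s') = 0 \<and> ?f (?P t') = 0"
        using zero m01
        by (smt (verit) mult_nonneg_nonneg mult_pos_pos mult_nonneg_nonpos mult_pos_neg
            sgn_le_0_iff zero_le_sgn_iff)
      then have "s' = s \<or> s' = t" "t' = s \<or> t' = t"
        using sgns by (auto simp: sgn_0_0)
      then have "u = v" using st st' u v by auto
      with \<open>u \<noteq> v\<close> show False by simp
    qed
  next
    assume ?interleaved
    then have sgn: "sgn (?f (?P s')) * sgn (?f (?P t')) < 0"
      unfolding sgns using st st' by (auto simp: sgn_if)
    \<comment> \<open>The zero of \<open>?f\<close> along \<open>v\<close>, by linear interpolation;
      the opposite signs place it strictly between 0 and 1.\<close>
    define m where "m = ?f (?P s') / (?f (?P s') - ?f (?P t'))"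
    define x where "x = ?P s' + of_real m * (?P t' - ?P s')"
    have opp: "?f (?P s') < 0 \<and> 0 < ?f (?P t') \<or> ?f (?P t') < 0 \<and> 0 < ?f (?P s')"
      using sgn by (auto simp: sgn_if split: if_splits)
    then have m: "0 < m" "m < 1" and zero: "?f x = 0"
      unfolding m_def x_def side_affine by (auto simp: field_simps)
    have ball: "x \<in> ball z r"
      unfolding x_def using line_in_ball_iff[OF sphere sphere ne(2)] m by blast
    obtain k where k: "x = ?P s + of_real k * (?P t - ?P s)"
      using side_eq_0_imp_line[OF zero ne(1)] by blast
    \<comment> \<open>A point of the line of \<open>u\<close> inside the disc already lies on the
      chord.\<close>
    then have "0 < k" "k < 1"
      using line_in_ball_iff[OF sphere sphere ne(1), of k] ball by auto
    then have "x \<in> u" unfolding u closed_segment_line using k by (auto intro: exI[of _ k])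
    moreover have "x \<in> v" unfolding v closed_segment_line using x_def m by (auto intro: exI[of _ m])
    moreover have "u \<noteq> v"
    proof
      assume "u = v"
      then have "?P s' \<in> closed_segment (?P s) (?P t)" using u v by (metis ends_in_segment(1))
      then have "?f (?P s') = 0" by (rule side_closed_segment)
      then show False using opp by simp
    qed
    ultimately show "chords_cross z r u v" using ball by (auto simp: chords_cross_def)
  qed
qed

section \<open>Interval models of circle graphs and the conclusion\<close>

text \<open>Each chord becomes the interval between the angles of its endpoints. Vertices are the
  chords themselves, so a vertex is recovered from its two angles, giving
  \<open>interval_inj\<close>.\<close>

lemma circle_graph_interval_model:
  assumes "circle_graph G"
  obtains lo hi where "interval_overlap_graph G lo hi"
proof -
  obtain z r V where r: "r > 0" and V: "finite V" "\<And>u. u \<in> V \<Longrightarrow> chord_of_circle z r u"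
    and G: "G = chord_graph z r V"
    using assms by (auto simp: circle_graph_def)
  have "\<forall>u\<in>V. \<exists>p. 0 \<le> fst p \<and> fst p < snd p \<and> snd p < 2 * pi \<and>
      u = closed_segment (circle_point z r (fst p)) (circle_point z r (snd p))"
  proof
    fix u assume "u \<in> V"
    then obtain s t where "0 \<le> s" "s < t" "t < 2 * pi"
      "u = closed_segment (circle_point z r s) (circle_point z r t)"
      using chord_arc V(2) by blast
    then show "\<exists>p. 0 \<le> fst p \<and> fst p < snd p \<and> snd p < 2 * pi \<and>
        u = closed_segment (circle_point z r (fst p)) (circle_point z r (snd p))"
      by (intro exI[of _ "(s, t)"]) simp
  qed
  from bchoice[OF this] obtain f where f: "\<forall>u\<in>V. 0 \<le> fst (f u) \<and> fst (f u) < snd (f u) \<and>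
      snd (f u) < 2 * pi \<and>
      u = closed_segment (circle_point z r (fst (f u))) (circle_point z r (snd (f u)))"
    by blast
  define lo hi where "lo = fst \<circ> f" and "hi = snd \<circ> f"
  have arc: "0 \<le> lo u" "lo u < hi u" "hi u < 2 * pi"
    "u = closed_segment (circle_point z r (lo u)) (circle_point z r (hi u))" if "u \<in> V" for u
    using f that by (auto simp: lo_def hi_def)
  have "interval_overlap_graph G lo hi"
  proof
    show "finite (pverts G)" using V by (simp add: G chord_graph_def)
    show "lo v < hi v" if "v \<in> pverts G" for v
      using that arc(2) by (simp add: G chord_graph_def)
    show "u = v" if "u \<in> pverts G" "v \<in> pverts G" "lo u = lo v" "hi u = hi v" for u v
      using that arc(4)[of u] arc(4)[of v] by (simp add: G chord_graph_def)
    show "(u, v) \<in> parcs G \<longleftrightarrow>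
        lo u < lo v \<and> lo v < hi u \<and> hi u < hi v \<or> lo v < lo u \<and> lo u < hi v \<and> hi v < hi u"
      if "u \<in> pverts G" "v \<in> pverts G" for u v
    proof -
      have uv: "u \<in> V" "v \<in> V" using that by (simp_all add: G chord_graph_def)
      have "(u, v) \<in> parcs G \<longleftrightarrow> chords_cross z r u v"
        using uv by (simp add: G chord_graph_def)
      also have "\<dots> \<longleftrightarrow>
        lo u < lo v \<and> lo v < hi u \<and> hi u < hi v \<or> lo v < lo u \<and> lo u < hi v \<and> hi v < hi u"
        by (rule chords_cross_iff[OF r arc(1-3)[OF uv(1)] arc(1-3)[OF uv(2)] arc(4)[OF uv(1)] arc(4)[OF uv(2)]])
      finally show ?thesis .
    qed
  qed
  then show thesis by (rule that)
qed

theorem theorem1p6: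
  fixes c :: real
  assumes "c > 0"
  shows "\<exists>C::real. \<forall>(n::nat) G.
           n \<ge> 1 \<longrightarrow> circle_graph G \<longrightarrow> card (pverts G) = n \<longrightarrow>
           real (independence_number G) = c * real n \<longrightarrow>
           real (hitting_number G) \<le> C * sqrt (real n)"
\<comment> \<open>The constant is introduced before \<open>n\<close> and \<open>G\<close>, so it can
  depend on \<open>c\<close> only; it becomes \<open>3 + 4 / c\<close>.\<close>
proof (intro exI allI impI)
  fix n :: nat and G
  assume G: "n \<ge> 1" "circle_graph G" "card (pverts G) = n"
    "real (independence_number G) = c * real n"
  obtain lo hi where "interval_overlap_graph G lo hi"
    using circle_graph_interval_model[OF G(2)] .
  then show "real (hitting_number G) \<le> (3 + 4 / c) * sqrt (real n)"
    using interval_overlap_graph.hitting_number_bound assms G by blast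
qed

end
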